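(* Let $k\ge 1$ and $n\ge 1$ be integers and suppose $U^{k}(\mathbb{Z}_{n})\approx\{0\}$. Then for all (positive) divisors $m$ of $n$, $U^{k}(\mathbb{Z}_{m})\approx\{0\}$.
   Context: For an integer $n\ge 1$, $\mathbb{Z}_n$ is the ring of integers modulo $n$ ($\mathbb{Z}_1=\{0\}$). For a finite commutative ring $R$ with identity (the zero ring is allowed, with $U(\{0\})=\{0\}$), $U(R)$ is its group of units. Since $U(R)$ is a finite abelian group, it is isomorphic to a product $\mathbb{Z}_{n_1}\times\cdots\times\mathbb{Z}_{n_i}$ of cyclic groups, and $U(R)$ is regarded as a ring by transporting the ring structure of $\mathbb{Z}_{n_1}\oplus\cdots\oplus\mathbb{Z}_{n_i}$ (up to ring isomorphism this does not depend on the chosen decomposition). The $k$-th (generalized) group of units is defined by $U^0(R)=R$, $U^1(R)=U(R)$ and $U^k(R)=U(U^{k-1}(R))$, where $U^{k-1}(R)$ is viewed as a ring in this way. The symbol $\approx$ denotes isomorphism (as groups, equivalently as rings with these structures). $\{0\}$ is the trivial group (ring). *)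

theory Defs
  imports "HOL-Algebra.Algebra"
begin

text \<open>For \<open>n \<ge> 1\<close> the library ring \<open>ZFact n\<close> is the ring of integers modulo \<open>n\<close>; unlike
  \<open>residue_ring\<close> it is a (zero) ring also for \<open>n = 1\<close>.\<close>

definition cyclic_sum :: "nat list \<Rightarrow> int set list ring"
  where "cyclic_sum ns = RDirProd_list (map (\<lambda>n. ZFact (int n)) ns)"

definition units_decomposition ::
    "('a, 'b) ring_scheme \<Rightarrow> nat list \<Rightarrow> (int set list \<Rightarrow> 'a) \<Rightarrow> bool"
  where "units_decomposition R ns \<phi> \<longleftrightarrow>
    (\<forall>n\<in>set ns. n \<ge> 1) \<and> \<phi> \<in> iso (add_monoid (cyclic_sum ns)) (units_of R)"

text \<open>The group of units, made into a ring by transporting the ring structure of a direct sum of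
  rings \<open>\<int>\<^sub>n\<close> along a group isomorphism. The carrier is \<open>Units R\<close>, the addition is the
  multiplication of \<open>R\<close>, and the zero is \<open>\<one>\<^bsub>R\<^esub>\<close>. The decomposition is chosen by \<open>SOME\<close>; up to ring
  isomorphism the result does not depend on it.\<close>

definition units_ring :: "('a, 'b) ring_scheme \<Rightarrow> 'a ring"
  where "units_ring R =
    (let (ns, \<phi>) = (SOME (ns, \<phi>). units_decomposition R ns \<phi>)
     in image_ring \<phi> (cyclic_sum ns))"

definition iterated_units :: "nat \<Rightarrow> 'a ring \<Rightarrow> 'a ring"
  where "iterated_units k R = (units_ring ^^ k) R"

definition zero_ring :: "int ring"
  where "zero_ring = \<lparr>carrier = {0}, monoid.mult = (\<lambda>x y. 0), one = 0, ring.zero = 0, add = (\<lambda>x y. 0)\<rparr>"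

lemma ring_cyclic_sum: "ring (cyclic_sum ns)"
  unfolding cyclic_sum_def
  by (rule RDirProd_list_is_ring) (simp add: ZFact_is_cring cring.axioms(1))

lemma units_ring_structure:
  assumes "ring R" and "units_decomposition R ns \<phi>"
  shows "ring (units_ring R)"
    and "carrier (units_ring R) = Units R"
    and "\<zero>\<^bsub>units_ring R\<^esub> = \<one>\<^bsub>R\<^esub>"
    and "\<lbrakk>x \<in> Units R; y \<in> Units R\<rbrakk> \<Longrightarrow> x \<oplus>\<^bsub>units_ring R\<^esub> y = x \<otimes>\<^bsub>R\<^esub> y"
    and "\<exists>ms. (\<forall>m\<in>set ms. m \<ge> 1) \<and> cyclic_sum ms \<simeq> units_ring R"
proof -
  obtain ms \<psi> where c: "(SOME (ns, \<phi>). units_decomposition R ns \<phi>) = (ms, \<psi>)"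
    by (rule surj_pair[THEN exE, of "SOME (ns, \<phi>). units_decomposition R ns \<phi>"]) blast
  have d: "units_decomposition R ms \<psi>"
  proof -
    have "case (SOME (ns, \<phi>). units_decomposition R ns \<phi>) of (ns, \<phi>) \<Rightarrow> units_decomposition R ns \<phi>"
      by (rule someI[where x = "(ns, \<phi>)"]) (simp add: assms(2))
    then show ?thesis by (simp only: c prod.case)
  qed
  have u: "units_ring R = image_ring \<psi> (cyclic_sum ms)"
    by (simp only: units_ring_def c Let_def prod.case)
  have hom: "\<psi> (a \<oplus>\<^bsub>cyclic_sum ms\<^esub> b) = \<psi> a \<otimes>\<^bsub>R\<^esub> \<psi> b"
      if "a \<in> carrier (cyclic_sum ms)" "b \<in> carrier (cyclic_sum ms)" for a b
    using d that by (auto simp: units_decomposition_def iso_def hom_def units_of_def)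
  have bij: "bij_betw \<psi> (carrier (cyclic_sum ms)) (Units R)"
    using d by (auto simp: units_decomposition_def iso_def units_of_def)
  then have inj: "inj_on \<psi> (carrier (cyclic_sum ms))"
    and im: "\<psi> ` carrier (cyclic_sum ms) = Units R"
    by (auto simp: bij_betw_def)
  interpret S: ring "cyclic_sum ms" by (rule ring_cyclic_sum)
  show "ring (units_ring R)"
    unfolding u by (rule S.inj_imp_image_ring_is_ring[OF inj])
  show "carrier (units_ring R) = Units R"
    unfolding u image_ring_carrier im ..
  show "x \<oplus>\<^bsub>units_ring R\<^esub> y = x \<otimes>\<^bsub>R\<^esub> y" if "x \<in> Units R" "y \<in> Units R"
  proof -
    from that have "x \<in> \<psi> ` carrier (cyclic_sum ms)" "y \<in> \<psi> ` carrier (cyclic_sum ms)"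
      by (simp_all only: im)
    then obtain a b where ab: "a \<in> carrier (cyclic_sum ms)" "b \<in> carrier (cyclic_sum ms)"
      and xy: "x = \<psi> a" "y = \<psi> b" by (elim imageE)
    have "x \<oplus>\<^bsub>units_ring R\<^esub> y = \<psi> (inv_into (carrier (cyclic_sum ms)) \<psi> x
        \<oplus>\<^bsub>cyclic_sum ms\<^esub> inv_into (carrier (cyclic_sum ms)) \<psi> y)"
      unfolding u image_ring_def image_group_def monoid.defs by simp
    also have "\<dots> = x \<otimes>\<^bsub>R\<^esub> y"
      unfolding xy inv_into_f_f[OF inj ab(1)] inv_into_f_f[OF inj ab(2)] by (rule hom[OF ab])
    finally show ?thesis .
  qed
  have z: "\<psi> \<zero>\<^bsub>cyclic_sum ms\<^esub> \<in> Units R" using im imageI[OF S.zero_closed] by metis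
  have zz: "\<psi> \<zero>\<^bsub>cyclic_sum ms\<^esub> \<otimes>\<^bsub>R\<^esub> \<psi> \<zero>\<^bsub>cyclic_sum ms\<^esub> = \<psi> \<zero>\<^bsub>cyclic_sum ms\<^esub>"
    using hom[of "\<zero>\<^bsub>cyclic_sum ms\<^esub>" "\<zero>\<^bsub>cyclic_sum ms\<^esub>"] by simp
  have u0: "\<zero>\<^bsub>units_ring R\<^esub> = \<psi> \<zero>\<^bsub>cyclic_sum ms\<^esub>"
    unfolding u image_ring_def image_group_def monoid.defs by simp
  show "\<exists>ms. (\<forall>m\<in>set ms. m \<ge> 1) \<and> cyclic_sum ms \<simeq> units_ring R"
  proof (intro exI conjI)
    show "\<forall>m\<in>set ms. m \<ge> 1" using d by (simp add: units_decomposition_def)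
    show "cyclic_sum ms \<simeq> units_ring R"
      unfolding u is_ring_iso_def using inj_imp_image_ring_iso[OF inj] by (metis empty_iff)
  qed
  show "\<zero>\<^bsub>units_ring R\<^esub> = \<one>\<^bsub>R\<^esub>"
  proof -
    interpret R: ring R by fact
    have "\<psi> \<zero>\<^bsub>cyclic_sum ms\<^esub> \<otimes>\<^bsub>R\<^esub> \<psi> \<zero>\<^bsub>cyclic_sum ms\<^esub>
        = \<psi> \<zero>\<^bsub>cyclic_sum ms\<^esub> \<otimes>\<^bsub>R\<^esub> \<one>\<^bsub>R\<^esub>"
      unfolding zz R.r_one[OF R.Units_closed[OF z]] ..
    then show ?thesis
      using R.Units_l_cancel[OF z R.Units_closed[OF z] R.one_closed] u0 by simp
  qed
qed

end

theory Submission
  imports Defs "HOL-Number_Theory.Residue_Primitive_Roots" "HOL-Number_Theory.Prime_Powers"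
begin

text \<open>
  Attach to a finite direct sum \<open>A\<close> of groups \<open>\<int>\<^sub>n\<close> the numbers \<open>N\<^sub>q(A)\<close>, for all prime powers \<open>q\<close>, of
  summands whose order is divisible by \<open>q\<close>. They depend on the group only (\<open>divisible_count_unique\<close>),
  because the number of elements killed by \<open>d\<close> is the product of the numbers \<open>gcd d n\<close>. They vanish
  exactly for the trivial group (\<open>cyclic_ring_trivial_iff\<close>). If \<open>m\<close> divides \<open>n\<close>, the numbers of \<open>\<int>\<^sub>m\<close> are at
  most those of \<open>\<int>\<^sub>n\<close>. So it suffices that such a domination between two rings passes to their groups
  of units; induction on \<open>k\<close> then gives the theorem.

  The counts of the group of units are a linear form with nonnegative coefficients in the counts of the ring.
  The Chinese remainder theorem splits the units of \<open>\<int>\<^sub>n\<close> into those modulo the prime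
  powers exactly dividing \<open>n\<close>. When the exponent of a prime \<open>p\<close> rises from \<open>a - 1\<close> to \<open>a\<close>, the orders
  of the cyclic factors of the units are replaced by multiples (\<open>unit_factors_dvd\<close>): for odd \<open>p\<close> the
  unit group is cyclic of order \<open>p^(a-1) (p-1)\<close>, and for \<open>p = 2\<close>, \<open>a \<ge> 3\<close> it is a product of cyclic
  groups of orders 2 and \<open>2^(a-2)\<close>. So this step adds a
  number \<open>w(q, p^a) \<ge> 0\<close> to the count at \<open>q\<close>. Hence the count at \<open>q\<close> of the units of \<open>\<int>\<^sub>n\<close> is the sum of \<open>w(q, r)\<close>
  over the prime powers \<open>r\<close> dividing \<open>n\<close>, and summation over the summands of \<open>A\<close> gives
  \<open>N\<^sub>q(U(A)) = (\<Sum>r. w(q, r) * N\<^sub>r(A))\<close> (\<open>cyclic_type_units_cyclic_sum\<close>, \<open>sum_list_primepow_factors\<close>), which is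
  monotone in the counts of \<open>A\<close>.
\<close>

section \<open>Counting torsion elements\<close>

definition torsion_count :: "('a, 'b) monoid_scheme \<Rightarrow> nat \<Rightarrow> nat"
  where "torsion_count G d = card {x \<in> carrier G. x [^]\<^bsub>G\<^esub> d = \<one>\<^bsub>G\<^esub>}"

lemma torsion_count_iso:
  assumes "group G" "group H" "G \<cong> H"
  shows "torsion_count G d = torsion_count H d"
proof -
  from assms(3) obtain h where h: "h \<in> iso G H" by (auto simp: is_iso_def)
  interpret h: group_hom G H h
    using assms(1,2) h by (auto simp: group_hom_def group_hom_axioms_def iso_def)
  have inj: "inj_on h (carrier G)" and im: "h ` carrier G = carrier H"
    using h by (auto simp: iso_iff)
  have one: "h x = \<one>\<^bsub>H\<^esub> \<longleftrightarrow> x = \<one>\<^bsub>G\<^esub>" if "x \<in> carrier G" for x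
    using inj_onD[OF inj, of x "\<one>\<^bsub>G\<^esub>"] that by auto
  have *: "h x [^]\<^bsub>H\<^esub> d = \<one>\<^bsub>H\<^esub> \<longleftrightarrow> x [^]\<^bsub>G\<^esub> d = \<one>\<^bsub>G\<^esub>" if "x \<in> carrier G" for x
    using that one[of "x [^]\<^bsub>G\<^esub> d"] by (simp add: h.hom_nat_pow)
  have "h ` {x \<in> carrier G. x [^]\<^bsub>G\<^esub> d = \<one>\<^bsub>G\<^esub>} = {x \<in> carrier H. x [^]\<^bsub>H\<^esub> d = \<one>\<^bsub>H\<^esub>}"
    unfolding im[symmetric] using * by blast
  then show ?thesis
    unfolding torsion_count_def
    using card_image[OF inj_on_subset[OF inj, of "{x \<in> carrier G. x [^]\<^bsub>G\<^esub> d = \<one>\<^bsub>G\<^esub>}"]] by auto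
qed

lemma torsion_count_bij_betw:
  assumes "bij_betw f A (carrier G)" and "\<And>x. x \<in> A \<Longrightarrow> f x [^]\<^bsub>G\<^esub> d = \<one>\<^bsub>G\<^esub> \<longleftrightarrow> P x"
  shows "torsion_count G d = card {x \<in> A. P x}"
proof -
  have "{x \<in> carrier G. x [^]\<^bsub>G\<^esub> d = \<one>\<^bsub>G\<^esub>} = f ` {x \<in> A. P x}"
    unfolding bij_betw_imp_surj_on[OF assms(1), symmetric] using assms(2) by auto
  moreover have "inj_on f {x \<in> A. P x}"
    using assms(1) by (auto simp: bij_betw_def elim!: inj_on_subset)
  ultimately show ?thesis by (simp add: torsion_count_def card_image)
qed

lemma torsion_count_trivial:
  assumes "group G" "carrier G = {\<one>\<^bsub>G\<^esub>}"
  shows "torsion_count G d = 1"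
proof -
  interpret group G by fact
  have "{x \<in> carrier G. x [^]\<^bsub>G\<^esub> d = \<one>\<^bsub>G\<^esub>} = {\<one>\<^bsub>G\<^esub>}" using assms(2) by auto
  then show ?thesis by (simp add: torsion_count_def)
qed

lemma nat_pow_DirProd:
  "(x, y) [^]\<^bsub>G \<times>\<times> H\<^esub> (d::nat) = (x [^]\<^bsub>G\<^esub> d, y [^]\<^bsub>H\<^esub> d)"
  by (induction d) simp_all

lemma torsion_count_DirProd: "torsion_count (G \<times>\<times> H) d = torsion_count G d * torsion_count H d"
proof -
  have "{x \<in> carrier (G \<times>\<times> H). x [^]\<^bsub>G \<times>\<times> H\<^esub> d = \<one>\<^bsub>G \<times>\<times> H\<^esub>}
    = {x \<in> carrier G. x [^]\<^bsub>G\<^esub> d = \<one>\<^bsub>G\<^esub>} \<times> {x \<in> carrier H. x [^]\<^bsub>H\<^esub> d = \<one>\<^bsub>H\<^esub>}"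
    by (auto simp: nat_pow_DirProd)
  then show ?thesis by (simp add: torsion_count_def card_cartesian_product)
qed

section \<open>Isomorphisms of rings, additive groups and unit groups\<close>

lemma ring_iso_add_monoid: "h \<in> ring_iso R S \<Longrightarrow> h \<in> iso (add_monoid R) (add_monoid S)"
  by (auto simp: ring_iso_def iso_def hom_def ring_hom_def)

lemma is_ring_iso_add_monoid: "R \<simeq> S \<Longrightarrow> add_monoid R \<cong> add_monoid S"
  using ring_iso_add_monoid unfolding is_ring_iso_def is_iso_def by blast

lemma is_ring_iso_units_of:
  assumes "ring R" "ring S" "R \<simeq> S"
  shows "units_of R \<cong> units_of S"
proof -
  from assms(3) obtain h where h: "h \<in> ring_iso R S" by (auto simp: is_ring_iso_def)
  have hom: "h \<in> ring_hom R S" and inj: "inj_on h (carrier R)" and im: "h ` carrier R = carrier S"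
    using h by (auto simp: ring_iso_def bij_betw_def)
  interpret R: ring R by fact
  interpret S: ring S by fact
  note mult = ring_hom_mult[OF hom] and one = ring_hom_one[OF hom]
  have "h ` Units R = Units S"
  proof (intro equalityI subsetI)
    fix y assume "y \<in> h ` Units R"
    then obtain x where x: "x \<in> Units R" "y = h x" by blast
    have "h x \<otimes>\<^bsub>S\<^esub> h (inv\<^bsub>R\<^esub> x) = \<one>\<^bsub>S\<^esub>" "h (inv\<^bsub>R\<^esub> x) \<otimes>\<^bsub>S\<^esub> h x = \<one>\<^bsub>S\<^esub>"
      using x by (simp_all add: mult[symmetric] one R.Units_closed)
    moreover have "h x \<in> carrier S" "h (inv\<^bsub>R\<^esub> x) \<in> carrier S"
      using x im R.Units_closed R.Units_inv_closed by blast+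
    ultimately show "y \<in> Units S" unfolding x(2) Units_def by blast
  next
    fix y assume y: "y \<in> Units S"
    then have "y \<in> h ` carrier R" "inv\<^bsub>S\<^esub> y \<in> h ` carrier R"
      using im S.Units_closed S.Units_inv_closed by blast+
    then obtain x z where xz: "x \<in> carrier R" "z \<in> carrier R" "y = h x" "inv\<^bsub>S\<^esub> y = h z" by blast
    have "h (x \<otimes>\<^bsub>R\<^esub> z) = h \<one>\<^bsub>R\<^esub>" "h (z \<otimes>\<^bsub>R\<^esub> x) = h \<one>\<^bsub>R\<^esub>"
      using xz S.Units_r_inv[OF y] S.Units_l_inv[OF y] by (simp_all add: mult one)
    then have "x \<otimes>\<^bsub>R\<^esub> z = \<one>\<^bsub>R\<^esub>" "z \<otimes>\<^bsub>R\<^esub> x = \<one>\<^bsub>R\<^esub>"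
      using xz inj_on_eq_iff[OF inj R.m_closed R.one_closed] by blast+
    then have "x \<in> Units R" using xz unfolding Units_def by blast
    then show "y \<in> h ` Units R" using xz by blast
  qed
  moreover have "inj_on h (Units R)"
    using inj by (rule inj_on_subset) auto
  ultimately have "h \<in> iso (units_of R) (units_of S)"
    by (auto simp: iso_iff hom_def units_of_def mult R.Units_closed)
  then show ?thesis by (rule is_isoI)
qed

lemma units_of_RDirProd: "units_of (RDirProd R S) \<cong> units_of R \<times>\<times> units_of S"
proof -
  have "Units (RDirProd R S) = Units R \<times> Units S"
    by (auto simp: Units_def RDirProd_def DirProd_def monoid.defs)
  then have "(\<lambda>x. x) \<in> iso (units_of (RDirProd R S)) (units_of R \<times>\<times> units_of S)"
    by (auto simp: iso_iff hom_def units_of_def RDirProd_def DirProd_def monoid.defs)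
  then show ?thesis by (rule is_isoI)
qed

lemma DirProd_assoc_iso: "(G \<times>\<times> H) \<times>\<times> I \<cong> G \<times>\<times> (H \<times>\<times> I)"
proof -
  have "(\<lambda>((x, y), z). (x, (y, z))) \<in> iso ((G \<times>\<times> H) \<times>\<times> I) (G \<times>\<times> (H \<times>\<times> I))"
    by (auto simp: iso_def hom_def inj_on_def bij_betw_def image_iff)
  then show ?thesis by (rule is_isoI)
qed

section \<open>Direct sums of the rings of integers modulo n\<close>

lemma cyclic_sum_Nil [simp]: "cyclic_sum [] = nil_ring"
  by (simp add: cyclic_sum_def)

lemma cyclic_sum_Cons: "RDirProd (ZFact (int n)) (cyclic_sum ns) \<simeq> cyclic_sum (n # ns)"
  using RDirProd_list_iso1 unfolding is_ring_iso_def cyclic_sum_def by fastforce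

lemma ring_ZFact: "ring (ZFact k)"
  using ZFact_is_cring cring.axioms(1) by blast

lemma group_add_monoid: "ring R \<Longrightarrow> group (add_monoid R)"
  by (simp add: abelian_group.a_group ring.is_abelian_group)

lemma group_cyclic_sum: "group (add_monoid (cyclic_sum ns))"
  by (rule group_add_monoid[OF ring_cyclic_sum])

lemma cyclic_sum_singleton: "cyclic_sum [n] \<simeq> ZFact (int n)"
proof -
  have "ZFact (int n) \<simeq> cyclic_sum [n]"
    using RDirProd_list_iso3[of "ZFact (int n)"] unfolding is_ring_iso_def cyclic_sum_def by auto
  then show ?thesis by (rule ring_iso_sym[OF ring_ZFact])
qed

lemma add_monoid_cyclic_sum_Cons:
  "add_monoid (ZFact (int n)) \<times>\<times> add_monoid (cyclic_sum ns) \<cong> add_monoid (cyclic_sum (n # ns))"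
  using is_ring_iso_add_monoid[OF cyclic_sum_Cons] unfolding RDirProd_add_monoid .

lemma cyclic_sum_append:
  "add_monoid (cyclic_sum ns) \<times>\<times> add_monoid (cyclic_sum ms) \<cong> add_monoid (cyclic_sum (ns @ ms))"
proof (induction ns)
  case Nil
  have "snd \<in> iso (add_monoid (cyclic_sum []) \<times>\<times> add_monoid (cyclic_sum ms)) (add_monoid (cyclic_sum ms))"
    by (auto simp: iso_iff hom_def inj_on_def monoid.defs image_iff)
  then show ?case by (auto intro: is_isoI)
next
  case (Cons n ns)
  let ?Z = "add_monoid (ZFact (int n))" and ?A = "\<lambda>ns. add_monoid (cyclic_sum ns)"
  have "?A (n # ns) \<times>\<times> ?A ms \<cong> (?Z \<times>\<times> ?A ns) \<times>\<times> ?A ms"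
    by (rule group.DirProd_iso_trans[OF group_cyclic_sum _ iso_refl])
      (rule group.iso_sym[OF _ add_monoid_cyclic_sum_Cons],
        intro DirProd_group group_add_monoid ring_ZFact ring_cyclic_sum)
  also have "\<dots> \<cong> ?Z \<times>\<times> (?A ns \<times>\<times> ?A ms)"
    by (rule DirProd_assoc_iso)
  also have "\<dots> \<cong> ?Z \<times>\<times> ?A (ns @ ms)"
    by (rule group.DirProd_iso_trans[OF group_add_monoid[OF ring_ZFact] iso_refl Cons.IH])
  also have "\<dots> \<cong> ?A (n # (ns @ ms))"
    by (rule add_monoid_cyclic_sum_Cons)
  finally show ?case by simp
qed

lemma ZMod_hom: "ZMod k \<in> ring_hom \<Z> (ZFact k)"
proof -
  have "ZMod k = (+>\<^bsub>\<Z>\<^esub>) (Idl\<^bsub>\<Z>\<^esub> {k})" by (simp add: ZMod_def fun_eq_iff)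
  then show ?thesis
    unfolding ZFact_def by (simp add: ideal.rcos_ring_hom int.genideal_ideal)
qed

lemma carrier_ZFact: "carrier (ZFact k) = range (ZMod k)"
  unfolding ZFact_defs A_RCOSETS_def' ZMod_def by auto

lemma ZMod_simps:
  "ZMod k x \<oplus>\<^bsub>ZFact k\<^esub> ZMod k y = ZMod k (x + y)"
  "ZMod k x \<otimes>\<^bsub>ZFact k\<^esub> ZMod k y = ZMod k (x * y)"
  "\<one>\<^bsub>ZFact k\<^esub> = ZMod k 1"
  "\<zero>\<^bsub>ZFact k\<^esub> = ZMod k 0"
  using ring_hom_mult[OF ZMod_hom] ring_hom_add[OF ZMod_hom] ring_hom_one[OF ZMod_hom]
    ring_hom_zero[OF ZMod_hom int.ring_axioms ring_ZFact]
  by auto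

lemma ZMod_nat_eq_iff: "ZMod (int n) (int x) = ZMod (int n) (int y) \<longleftrightarrow> [x = y] (mod n)"
  by (simp add: ZMod_eq_mod cong_def flip: zmod_int)

lemma bij_betw_carrier_ZFact:
  assumes "n \<ge> 1"
  shows "bij_betw (\<lambda>x. ZMod (int n) (int x)) {..<n} (carrier (ZFact (int n)))"
proof -
  have "inj_on (\<lambda>x. ZMod (int n) (int x)) {..<n}"
    by (auto simp: inj_on_def ZMod_nat_eq_iff cong_def)
  moreover have "ZMod (int n) x \<in> (\<lambda>x. ZMod (int n) (int x)) ` {..<n}" for x
  proof -
    have "ZMod (int n) x = ZMod (int n) (int (nat (x mod int n)))" 
      using assms by (simp add: ZMod_eq_mod)
    moreover have "nat (x mod int n) < n" 
      using assms pos_mod_bound[of "int n" x] pos_mod_sign[of "int n" x] by linarith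
    ultimately show ?thesis by blast
  qed
  ultimately show ?thesis by (auto simp: bij_betw_def carrier_ZFact)
qed

lemma pow_add_monoid_ZFact:
  "ZMod k x [^]\<^bsub>add_monoid (ZFact k)\<^esub> (d::nat) = ZMod k (int d * x)"
  by (induction d) (simp_all add: ZMod_simps algebra_simps)

text \<open>Modulo \<open>n\<close>, \<open>d x = 0\<close> says that \<open>x\<close> is a multiple of \<open>n / gcd d n\<close>, and there are
  \<open>gcd d n\<close> such residues.\<close>

lemma torsion_count_ZFact:
  assumes "n \<ge> 1"
  shows "torsion_count (add_monoid (ZFact (int n))) d = gcd d n"
proof -
  let ?z = "\<lambda>x. ZMod (int n) (int x)"
  define g where "g = gcd d n"
  have "g > 0" using assms by (simp add: g_def)
  obtain d' m where dm: "d = d' * g" "n = m * g" "coprime d' m"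
    using gcd_coprime_exists[of d n] \<open>g > 0\<close> unfolding g_def by auto
  have "m > 0" using dm assms by (cases m) auto
  have eq: "?z x [^]\<^bsub>add_monoid (ZFact (int n))\<^esub> d = \<zero>\<^bsub>ZFact (int n)\<^esub> \<longleftrightarrow> n dvd d * x" for x
    using ZMod_nat_eq_iff[of n "d * x" 0]
    unfolding pow_add_monoid_ZFact unfolding ZMod_simps(4) cong_0_iff by simp
  have dvd: "n dvd d * x \<longleftrightarrow> m dvd x" for x
  proof -
    have "n dvd d * x \<longleftrightarrow> m * g dvd (d' * x) * g" by (simp add: dm ac_simps)
    also have "\<dots> \<longleftrightarrow> m dvd d' * x" using \<open>g > 0\<close> by simp
    also have "\<dots> \<longleftrightarrow> m dvd x" using dm(3) by (simp add: coprime_dvd_mult_right_iff coprime_commute)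
    finally show ?thesis .
  qed
  have "torsion_count (add_monoid (ZFact (int n))) d = card {x \<in> {..<n}. m dvd x}"
    by (rule torsion_count_bij_betw[where f = ?z])
      (simp_all add: bij_betw_carrier_ZFact[OF assms] eq[simplified] dvd)
  also have "{x \<in> {..<n}. m dvd x} = {x. x < n \<and> m dvd x}" by auto
  also have "{x. x < n \<and> m dvd x} = (\<lambda>i. m * i) ` {..<g}"
    using \<open>m > 0\<close> by (auto simp: dm(2) elim!: dvdE)
  also have "card \<dots> = g"
    using \<open>m > 0\<close> by (simp add: card_image inj_on_def)
  finally show ?thesis by (simp add: g_def)
qed

lemma torsion_count_cyclic_sum:
  assumes "\<forall>n\<in>set ns. n \<ge> 1"
  shows "torsion_count (add_monoid (cyclic_sum ns)) d = (\<Prod>n\<leftarrow>ns. gcd d n)"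
  using assms
proof (induction ns)
  case Nil
  have "carrier (add_monoid (cyclic_sum [])) = {\<one>\<^bsub>add_monoid (cyclic_sum [])\<^esub>}"
    by (simp add: monoid.defs)
  from torsion_count_trivial[OF group_cyclic_sum this] show ?case by (simp only: list.map prod_list.Nil)
next
  case (Cons n ns)
  have "torsion_count (add_monoid (cyclic_sum (n # ns))) d =
      torsion_count (add_monoid (ZFact (int n)) \<times>\<times> add_monoid (cyclic_sum ns)) d"
    by (intro torsion_count_iso[symmetric] DirProd_group add_monoid_cyclic_sum_Cons group_add_monoid
        ring_ZFact ring_cyclic_sum)
  also have "\<dots> = gcd d n * (\<Prod>n\<leftarrow>ns. gcd d n)"
    unfolding torsion_count_DirProd using Cons by (metis list.set_intros(1,2) torsion_count_ZFact)
  finally show ?case by simp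
qed

section \<open>Prime power counts as isomorphism invariants\<close>

text \<open>For a prime power \<open>q = p^j\<close> with \<open>j \<ge> 1\<close> this is the number of \<open>p\<close>-primary cyclic summands of order at least \<open>q\<close>
  in the direct sum of the \<open>\<int>\<^sub>n\<close>. These numbers are the column lengths of the Young diagrams
  that classify finite abelian groups.\<close>

definition divisible_count :: "nat \<Rightarrow> nat list \<Rightarrow> nat"
  where "divisible_count q ns = length (filter (\<lambda>n. q dvd n) ns)"

lemma divisible_count_simps [simp]:
  "divisible_count q [] = 0"
  "divisible_count q (n # ns) = (if q dvd n then 1 else 0) + divisible_count q ns"
  "divisible_count q (ns @ ms) = divisible_count q ns + divisible_count q ms"
  by (simp_all add: divisible_count_def)

lemma gcd_prime_power_Suc:
  assumes "Factorial_Ring.prime (p::nat)"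
  shows "gcd (p ^ Suc j) n = (if p ^ Suc j dvd n then p else 1) * gcd (p ^ j) n"
proof (cases "p ^ Suc j dvd n")
  case True
  then have "p ^ j dvd n" by (metis dvd_mult_right power_Suc)
  with True show ?thesis by (simp add: gcd_nat.absorb1 del: power_Suc) simp
next
  case False
  obtain i where i: "i \<le> Suc j" "gcd (p ^ Suc j) n = p ^ i"
    using divides_primepow_nat[OF assms] by (metis gcd_dvd1)
  from False i have "i \<noteq> Suc j" by (metis gcd_dvd2)
  then have "i \<le> j" using i by simp
  then have "p ^ i dvd gcd (p ^ j) n" using i by (metis gcd_dvd2 gcd_greatest le_imp_power_dvd)
  moreover have "gcd (p ^ j) n dvd gcd (p ^ Suc j) n" by (intro gcd_mono) auto
  ultimately have "gcd (p ^ Suc j) n = gcd (p ^ j) n" unfolding i(2) by (rule dvd_antisym)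
  then show ?thesis using False by (simp only: if_False mult_1)
qed

lemma prod_list_gcd_prime_power_Suc:
  assumes "Factorial_Ring.prime (p::nat)" "q = p ^ Suc j"
  shows "(\<Prod>n\<leftarrow>ns. gcd q n) = p ^ divisible_count q ns * (\<Prod>n\<leftarrow>ns. gcd (p ^ j) n)"
proof (induction ns)
  case (Cons n ns)
  have "gcd q n = (if q dvd n then p else 1) * gcd (p ^ j) n"
    unfolding assms(2) by (rule gcd_prime_power_Suc[OF assms(1)])
  with Cons.IH show ?case by simp
qed simp

text \<open>The counts can be read off the group. For \<open>q = p^(j+1)\<close>, the numbers of elements killed by \<open>p^(j+1)\<close> and by
  \<open>p^j\<close> are products of gcds, and their quotient contributes one factor \<open>p\<close> for each order divisible by
  \<open>q\<close>. This is what makes the arbitrary choice of a decomposition in \<open>units_ring\<close> harmless.\<close>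

lemma divisible_count_unique:
  assumes "\<forall>n\<in>set ns. n \<ge> 1" "\<forall>n\<in>set ms. n \<ge> 1"
    and "add_monoid (cyclic_sum ns) \<cong> add_monoid (cyclic_sum ms)" and "primepow q"
  shows "divisible_count q ns = divisible_count q ms"
proof -
  obtain p k where p: "Factorial_Ring.prime p" "k > 0" "q = p ^ k" using \<open>primepow q\<close> by (auto simp: primepow_def)
  then obtain j where q: "q = p ^ Suc j" by (metis gr0_conv_Suc)
  have eq: "(\<Prod>n\<leftarrow>ns. gcd d n) = (\<Prod>n\<leftarrow>ms. gcd d n)" for d
    using torsion_count_iso[OF group_cyclic_sum group_cyclic_sum assms(3), of d]
    unfolding torsion_count_cyclic_sum[OF assms(1)] torsion_count_cyclic_sum[OF assms(2)] .
  have "(\<Prod>n\<leftarrow>ns. gcd (p ^ j) n) \<noteq> 0" using assms(1) by (auto simp: prod_list_zero_iff)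
  then have "p ^ divisible_count q ns = p ^ divisible_count q ms"
    using eq[of q] eq[of "p ^ j"]
    unfolding prod_list_gcd_prime_power_Suc[OF p(1) q] by simp
  then show ?thesis using prime_gt_1_nat[OF p(1)] by (simp add: power_inject_exp)
qed

section \<open>Groups of given cyclic type\<close>

definition cyclic_type :: "('a, 'b) monoid_scheme \<Rightarrow> nat list \<Rightarrow> bool"
  where "cyclic_type G ns \<longleftrightarrow> (\<forall>n\<in>set ns. n \<ge> 1) \<and> add_monoid (cyclic_sum ns) \<cong> G"

lemma cyclic_type_iso: "cyclic_type G ns \<Longrightarrow> G \<cong> H \<Longrightarrow> cyclic_type H ns"
  unfolding cyclic_type_def using iso_trans by blast

lemma cyclic_type_DirProd:
  assumes "group G" "group H" "cyclic_type G ns" "cyclic_type H ms"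
  shows "cyclic_type (G \<times>\<times> H) (ns @ ms)"
proof -
  have "add_monoid (cyclic_sum (ns @ ms)) \<cong> add_monoid (cyclic_sum ns) \<times>\<times> add_monoid (cyclic_sum ms)"
    by (rule group.iso_sym[OF DirProd_group[OF group_cyclic_sum group_cyclic_sum] cyclic_sum_append])
  also have "\<dots> \<cong> G \<times>\<times> H"
    using assms(3,4) unfolding cyclic_type_def by (intro group.DirProd_iso_trans[OF group_cyclic_sum]) auto
  finally show ?thesis using assms(3,4) by (auto simp: cyclic_type_def)
qed

lemma cyclic_type_ZFact:
  assumes "n \<ge> 1"
  shows "cyclic_type (add_monoid (ZFact (int n))) [n]"
  using assms is_ring_iso_add_monoid[OF cyclic_sum_singleton, of n] unfolding cyclic_type_def
  by (metis empty_iff empty_set set_ConsD)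

lemma (in group) pow_cong:
  assumes "g \<in> carrier G" "g [^] (n::nat) = \<one>" "[i = j] (mod n)"
  shows "g [^] i = g [^] j"
proof -
  have "g [^] i = g [^] (i mod n)" for i
  proof -
    have "g [^] i = g [^] (n * (i div n) + i mod n)" by simp
    also have "\<dots> = (g [^] n) [^] (i div n) \<otimes> g [^] (i mod n)"
      using assms(1) by (simp only: nat_pow_mult[symmetric] nat_pow_pow[symmetric] nat_pow_closed)
    finally show ?thesis using assms by simp
  qed
  then show ?thesis using assms(3) unfolding cong_def by metis
qed

lemma ZFact_nat_representative:
  assumes "u \<in> carrier (ZFact (int n))" "n \<ge> 1"
  shows "\<exists>i. u = ZMod (int n) (int i)"
  using bij_betw_carrier_ZFact[OF assms(2)] assms(1) unfolding bij_betw_def by blast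

text \<open>A map out of \<open>\<int>\<^sub>n\<close> may be defined by choosing any natural number that represents a residue
  class, because \<open>g^n = 1\<close>.\<close>

lemma (in group) ZFact_hom_exists:
  assumes g: "g \<in> carrier G" "g [^] n = \<one>" and n: "n \<ge> (1::nat)"
  shows "\<exists>f \<in> hom (add_monoid (ZFact (int n))) G. \<forall>i. f (ZMod (int n) (int i)) = g [^] i"
proof -
  define f where "f u = g [^] (SOME i. ZMod (int n) (int i) = u)" for u
  have f: "f (ZMod (int n) (int i)) = g [^] i" for i
  proof -
    have "ZMod (int n) (int (SOME j. ZMod (int n) (int j) = ZMod (int n) (int i))) = ZMod (int n) (int i)"
      by (rule someI[of _ i]) simp
    then show ?thesis unfolding f_def ZMod_nat_eq_iff by (rule pow_cong[OF g])
  qed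
  have "f \<in> hom (add_monoid (ZFact (int n))) G"
  proof (rule homI)
    fix u assume "u \<in> carrier (add_monoid (ZFact (int n)))"
    then obtain i where "u = ZMod (int n) (int i)" using n by (auto dest: ZFact_nat_representative)
    then show "f u \<in> carrier G" using f g by simp
  next
    fix u v assume "u \<in> carrier (add_monoid (ZFact (int n)))" "v \<in> carrier (add_monoid (ZFact (int n)))"
    then obtain i j where "u = ZMod (int n) (int i)" "v = ZMod (int n) (int j)"
      using n by (metis ZFact_nat_representative partial_object.select_convs(1))
    then show "f (u \<otimes>\<^bsub>add_monoid (ZFact (int n))\<^esub> v) = f u \<otimes> f v"
      using f[of i] f[of j] f[of "i + j"] g by (simp add: ZMod_simps nat_pow_mult)
  qed
  with f show ?thesis by blast
qed

text \<open>Two independent elements give an embedding of \<open>\<int>\<^sub>a \<oplus> \<int>\<^sub>b\<close>, and equality of the orders makes it onto. One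
  generator is the case \<open>b = 1\<close>. No unit group modulo a prime power needs more than two generators.\<close>

lemma (in comm_group) cyclic_type_two_generators:
  assumes fin: "finite (carrier G)" and g: "g \<in> carrier G" "g [^] a = \<one>" "a \<ge> (1::nat)"
    and h: "h \<in> carrier G" "h [^] b = \<one>" "b \<ge> (1::nat)"
    and indep: "\<And>i j :: nat. g [^] i \<otimes> h [^] j = \<one> \<Longrightarrow> a dvd i \<and> b dvd j"
    and card: "card (carrier G) = a * b"
  shows "cyclic_type G [a, b]"
proof -
  let ?A = "add_monoid (ZFact (int a))" and ?B = "add_monoid (ZFact (int b))"
  obtain f where f: "f \<in> hom ?A G" "\<And>i. f (ZMod (int a) (int i)) = g [^] i"
    using ZFact_hom_exists[OF g] by blast
  obtain f' where f': "f' \<in> hom ?B G" "\<And>i. f' (ZMod (int b) (int i)) = h [^] i"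
    using ZFact_hom_exists[OF h] by blast
  define F where "F = (\<lambda>(u, v). f u \<otimes> f' v)"
  have AB: "group (?A \<times>\<times> ?B)" by (intro DirProd_group group_add_monoid ring_ZFact)
  have hom: "F \<in> hom (?A \<times>\<times> ?B) G"
  proof (rule homI)
    show "F x \<in> carrier G" if "x \<in> carrier (?A \<times>\<times> ?B)" for x
      using that f(1) f'(1) by (auto simp: F_def hom_def)
    show "F (x \<otimes>\<^bsub>?A \<times>\<times> ?B\<^esub> y) = F x \<otimes> F y"
      if "x \<in> carrier (?A \<times>\<times> ?B)" "y \<in> carrier (?A \<times>\<times> ?B)" for x y
    proof -
      obtain x1 x2 y1 y2 where xy: "x = (x1, x2)" "y = (y1, y2)" by (metis surj_pair)
      have c: "x1 \<in> carrier ?A" "x2 \<in> carrier ?B" "y1 \<in> carrier ?A" "y2 \<in> carrier ?B"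
        using that unfolding xy by simp_all
      show ?thesis
        unfolding xy F_def mult_DirProd prod.case hom_mult[OF f(1) c(1,3)] hom_mult[OF f'(1) c(2,4)]
        using hom_in_carrier[OF f(1) c(1)] hom_in_carrier[OF f(1) c(3)]
          hom_in_carrier[OF f'(1) c(2)] hom_in_carrier[OF f'(1) c(4)]
        by (simp add: m_ac)
    qed
  qed
  have "inj_on F (carrier (?A \<times>\<times> ?B))"
  proof -
    interpret F: group_hom "?A \<times>\<times> ?B" G F
      using AB is_group hom by (simp add: group_hom_def group_hom_axioms_def)
    have "x = \<one>\<^bsub>?A \<times>\<times> ?B\<^esub>" if x: "x \<in> carrier (?A \<times>\<times> ?B)" "F x = \<one>" for x
    proof -
      obtain u v where XY: "x = (u, v)" by fastforce
      then have "u \<in> carrier (ZFact (int a))" "v \<in> carrier (ZFact (int b))" using x by auto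
      then obtain i j where ij: "u = ZMod (int a) (int i)" "v = ZMod (int b) (int j)"
        using g(3) h(3) by (metis ZFact_nat_representative)
      have "a dvd i \<and> b dvd j"
        by (rule indep) (use x(2) in \<open>simp add: XY ij F_def f(2) f'(2)\<close>)
      then have "u = ZMod (int a) (int 0)" "v = ZMod (int b) (int 0)"
        unfolding ij ZMod_nat_eq_iff by (auto simp: cong_0_iff)
      then show ?thesis by (simp add: XY ZMod_simps)
    qed
    then show ?thesis using F.inj_on_one_iff by blast
  qed
  moreover have "F ` carrier (?A \<times>\<times> ?B) = carrier G"
  proof (rule card_subset_eq[OF fin])
    show "F ` carrier (?A \<times>\<times> ?B) \<subseteq> carrier G" using hom by (auto simp: hom_def)
    show "card (F ` carrier (?A \<times>\<times> ?B)) = card (carrier G)"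
      unfolding card_image[OF calculation] card
      using bij_betw_same_card[OF bij_betw_carrier_ZFact[OF g(3)]] bij_betw_same_card[OF bij_betw_carrier_ZFact[OF h(3)]]
      by (simp add: card_cartesian_product)
  qed
  ultimately have "?A \<times>\<times> ?B \<cong> G" using hom by (intro is_isoI[of F]) (simp only: iso_iff)
  moreover have "cyclic_type (?A \<times>\<times> ?B) [a, b]"
    using cyclic_type_DirProd[OF group_add_monoid group_add_monoid cyclic_type_ZFact cyclic_type_ZFact]
      g(3) h(3) ring_ZFact by fastforce
  ultimately show ?thesis using cyclic_type_iso by blast
qed

section \<open>Unit groups of the rings of integers modulo prime powers\<close>

lemma ZMod_in_Units_iff: "ZMod k x \<in> Units (ZFact k) \<longleftrightarrow> coprime x k"
proof -
  have "ZMod k x \<in> Units (ZFact k) \<longleftrightarrow> (\<exists>y. [x * y = 1] (mod k))"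
    by (auto simp: Units_def carrier_ZFact ZMod_simps ZMod_eq_mod cong_def mult.commute)
  then show ?thesis by (simp add: coprime_iff_invertible_int)
qed

lemma card_Units_ZFact:
  assumes "n \<ge> 1"
  shows "card (Units (ZFact (int n))) = totient n" "finite (Units (ZFact (int n)))"
proof -
  let ?z = "\<lambda>x. ZMod (int n) (int x)"
  have z: "inj_on ?z {..<n}" "?z ` {..<n} = carrier (ZFact (int n))"
    using bij_betw_carrier_ZFact[OF assms] by (simp_all add: bij_betw_def)
  have "Units (ZFact (int n)) = ?z ` {x \<in> {..<n}. coprime x n}"
  proof -
    have "Units (ZFact (int n)) = {u \<in> ?z ` {..<n}. u \<in> Units (ZFact (int n))}"
      unfolding z(2) by (auto simp: Units_def)
    also have "\<dots> = ?z ` {x \<in> {..<n}. ?z x \<in> Units (ZFact (int n))}" by blast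
    finally show ?thesis by (simp only: ZMod_in_Units_iff coprime_int_iff)
  qed
  moreover have "inj_on ?z {x \<in> {..<n}. coprime x n}"
    using z(1) by (rule inj_on_subset) auto
  moreover have "card {x \<in> {..<n}. coprime x n} = totient n"
  proof (cases "n = 1")
    case True
    then have "{x \<in> {..<n}. coprime x n} = {0}" by auto
    then show ?thesis using True by simp
  next
    case False
    have "{x \<in> {..<n}. coprime x n} = totatives n"
    proof (intro equalityI subsetI)
      fix x assume "x \<in> {x \<in> {..<n}. coprime x n}"
      then show "x \<in> totatives n" using False by (cases "x = 0") (auto simp: totatives_def)
    next
      fix x assume "x \<in> totatives n"
      then show "x \<in> {x \<in> {..<n}. coprime x n}"
        using False by (cases "x = n") (auto simp: totatives_def)
    qed
    then show ?thesis by (simp add: totient_def)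
  qed
  ultimately show "card (Units (ZFact (int n))) = totient n" "finite (Units (ZFact (int n)))"
    by (simp_all add: card_image)
qed

lemma pow_units_of_ZFact: "ZMod k x [^]\<^bsub>units_of (ZFact k)\<^esub> (i::nat) = ZMod k (x ^ i)"
  by (induction i) (simp_all add: units_of_def ZMod_simps mult.commute)

lemma cyclic_type_units_ZFact:
  assumes n: "n \<ge> 1" and g: "coprime g n" "[g ^ a = 1] (mod n)" "a \<ge> 1"
    and h: "coprime h n" "[h ^ b = 1] (mod n)" "b \<ge> 1"
    and indep: "\<And>i j :: nat. [g ^ i * h ^ j = 1] (mod n) \<Longrightarrow> a dvd i \<and> b dvd j"
    and card: "totient n = a * b"
  shows "cyclic_type (units_of (ZFact (int n))) [a, b]"
proof -
  let ?U = "units_of (ZFact (int n))" and ?z = "\<lambda>x. ZMod (int n) (int x)"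
  interpret R: cring "ZFact (int n)" by (rule ZFact_is_cring)
  have pow: "?z x [^]\<^bsub>?U\<^esub> i = ?z (x ^ i)" for x i by (simp add: pow_units_of_ZFact)
  have mult: "?z x \<otimes>\<^bsub>?U\<^esub> ?z y = ?z (x * y)" for x y by (simp add: units_of_def ZMod_simps)
  have one: "\<one>\<^bsub>?U\<^esub> = ?z 1" by (simp add: units_of_def ZMod_simps)
  show ?thesis
  proof (rule comm_group.cyclic_type_two_generators[where g = "?z g" and h = "?z h"])
    show "comm_group ?U" by (rule R.units_comm_group)
    show "finite (carrier ?U)" "card (carrier ?U) = a * b"
      using card_Units_ZFact[OF n] card by (simp_all add: units_of_carrier)
    show "?z g \<in> carrier ?U" "?z h \<in> carrier ?U"
      using g h by (simp_all add: units_of_carrier ZMod_in_Units_iff)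
    show "?z g [^]\<^bsub>?U\<^esub> a = \<one>\<^bsub>?U\<^esub>" "?z h [^]\<^bsub>?U\<^esub> b = \<one>\<^bsub>?U\<^esub>"
      unfolding pow one ZMod_nat_eq_iff by (rule g h)+
    show "a dvd i \<and> b dvd j" if "?z g [^]\<^bsub>?U\<^esub> i \<otimes>\<^bsub>?U\<^esub> ?z h [^]\<^bsub>?U\<^esub> j = \<one>\<^bsub>?U\<^esub>" for i j
      using that unfolding pow mult one ZMod_nat_eq_iff by (rule indep)
  qed (rule g h)+
qed

lemma cyclic_type_units_primroot:
  assumes "residue_primroot n g"
  shows "cyclic_type (units_of (ZFact (int n))) [totient n, 1]"
proof (rule cyclic_type_units_ZFact[where g = g and h = 1])
  show "n \<ge> 1" "coprime g n" "totient n \<ge> 1"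
    using assms by (auto simp: residue_primroot_def coprime_commute Suc_le_eq)
  show "[g ^ totient n = 1] (mod n)"
    using \<open>coprime g n\<close> by (rule euler_theorem)
  show "totient n dvd i \<and> 1 dvd j" if "[g ^ i * 1 ^ j = 1] (mod n)" for i j
    using that assms by (simp add: ord_divides' residue_primroot_def)
qed simp_all

text \<open>The units modulo \<open>2^k\<close> are generated by \<open>-1\<close>, of order 2, and by 3, of order \<open>2^(k-2)\<close>. They are
  independent already modulo 8: the powers of 3 are 1 and 3 there, so no odd power of \<open>-1\<close>
  is a power of 3.\<close>

lemma cyclic_type_units_twopow:
  assumes "k \<ge> 3"
  shows "cyclic_type (units_of (ZFact (int (2 ^ k)))) [2, 2 ^ (k - 2)]"
  \<comment> \<open>The residue \<open>-1\<close> is represented by the natural number \<open>2^k - 1\<close>.\<close>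
proof (rule cyclic_type_units_ZFact[where g = "2 ^ k - 1" and h = 3])
  obtain l where k: "k = l + 3" using assms by (metis le_add_diff_inverse2)
  let ?g = "2 ^ k - 1 :: nat"
  have g_sq: "[?g ^ 2 = 1] (mod 2 ^ k)"
  proof -
    have "int (?g ^ 2) = (2 ^ k - 1)\<^sup>2" by (simp add: of_nat_diff)
    also have "\<dots> = 1 + 2 ^ k * (2 ^ k - 2)" by (simp add: power2_eq_square algebra_simps)
    also have "[\<dots> = 1] (mod 2 ^ k)" by (simp add: cong_iff_dvd_diff)
    finally show ?thesis by (simp flip: cong_int_iff)
  qed
  have ord: "ord (2 ^ k) (3::nat) = 2 ^ (k - 2)" using ord_twopow_3_5[OF assms, of 3] by simp
  show "[?g ^ 2 = 1] (mod 2 ^ k)" by (rule g_sq)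
  show "[3 ^ 2 ^ (k - 2) = 1] (mod (2::nat) ^ k)" using ord_divides[of 3 "2 ^ (k - 2)" "2 ^ k"] ord by auto
  show "coprime ?g (2 ^ k)" by (rule coprime_diff_one_left_nat) simp
  show "totient (2 ^ k) = 2 * 2 ^ (k - 2)" by (simp add: totient_prime_power k)
  show "2 dvd i \<and> 2 ^ (k - 2) dvd j" if *: "[?g ^ i * 3 ^ j = 1] (mod 2 ^ k)" for i j
  proof -
    have m7: "(7::nat) ^ i mod 8 = (if even i then 1 else 7)"
    proof (induction i)
      case (Suc i)
      have "(7::nat) ^ Suc i mod 8 = 7 * (7 ^ i mod 8) mod 8" by (simp add: mod_mult_right_eq)
      with Suc show ?case by simp
    qed simp
    have m3: "(3::nat) ^ j mod 8 = (if even j then 1 else 3)"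
    proof (induction j)
      case (Suc j)
      have "(3::nat) ^ Suc j mod 8 = 3 * (3 ^ j mod 8) mod 8" by (simp add: mod_mult_right_eq)
      with Suc show ?case by simp
    qed simp
    have "[?g = 7] (mod 8)"
    proof -
      have "?g = 8 * (2 ^ l - 1) + 7" by (simp add: k power_add diff_mult_distrib2)
      then show ?thesis by (simp add: cong_def)
    qed
    moreover have "[?g ^ i * 3 ^ j = 1] (mod 8)"
      using * by (rule cong_dvd_modulus_nat) (simp add: k power_add)
    ultimately have "[7 ^ i * 3 ^ j = 1] (mod (8::nat))"
      by (meson cong_pow cong_scalar_right cong_sym cong_trans)
    then have "((7::nat) ^ i mod 8) * (3 ^ j mod 8) mod 8 = 1"
      by (simp add: cong_def mod_mult_eq)
    then have "even i" unfolding m7 m3 by (auto split: if_splits)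
    then obtain i' where "i = 2 * i'" by blast
    then have "[?g ^ i = 1] (mod 2 ^ k)" using cong_pow[OF g_sq, of i'] by (simp only: power_mult power_one)
    then have "[1 * 3 ^ j = 1] (mod (2::nat) ^ k)"
      using * by (meson cong_scalar_right cong_sym cong_trans)
    then show ?thesis using \<open>even i\<close> ord ord_divides'[of 3 j "2 ^ k"] by simp
  qed
qed simp_all

text \<open>A list of exactly two orders is used throughout, with 1 for an absent
  generator, so that the lists for consecutive exponents can be compared entry by entry.\<close>

definition unit_factors :: "nat \<Rightarrow> nat \<Rightarrow> nat list"
  where "unit_factors p a = (if p = 2 \<and> a \<ge> 3 then [2, 2 ^ (a - 2)] else [totient (p ^ a), 1])"

lemma cyclic_type_units_prime_power:
  assumes "Factorial_Ring.prime p"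
  shows "cyclic_type (units_of (ZFact (int (p ^ a)))) (unit_factors p a)"
proof (cases "p = 2 \<and> a \<ge> 3")
  case True
  then show ?thesis using cyclic_type_units_twopow[of a] by (simp add: unit_factors_def)
next
  case False
  \<comment> \<open>What remains are the moduli 1, 2, 4 and the powers of odd primes, all with a primitive root.\<close>
  have "p ^ a \<in> cyclic_moduli"
  proof (cases "p = 2")
    case True
    then have "a = 0 \<or> a = 1 \<or> a = 2" using False by auto
    then show ?thesis using True by (auto simp: cyclic_moduli_def)
  next
    case False
    then have "odd p" using assms primes_dvd_imp_eq two_is_prime_nat by blast
    then show ?thesis using assms by (cases "a = 0") (auto simp: cyclic_moduli_def)
  qed
  then obtain g where "residue_primroot (p ^ a) g" using residue_primroot_iff_in_cyclic_moduli by blast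
  then show ?thesis
    using False cyclic_type_units_primroot[of "p ^ a" g] by (simp only: unit_factors_def if_False)
qed

section \<open>Unit groups of direct sums\<close>

lemma ZFact_mult_coprime:
  assumes "coprime m n"
  shows "ZFact (m * n) \<simeq> RDirProd (ZFact m) (ZFact n)"
proof -
  let ?I = "\<lambda>k. Idl\<^bsub>\<Z>\<^esub> {k}"
  have mem: "x \<in> ?I k \<longleftrightarrow> k dvd x" for k x by (auto simp: int_Idl dvd_def mult.commute)
  have "?I m \<inter> ?I n = ?I (m * n)"
    using assms by (auto simp: mem divides_mult dest: dvd_mult_left dvd_mult_right)
  moreover have "?I m <+>\<^bsub>\<Z>\<^esub> ?I n = carrier \<Z>"
  proof -
    obtain a b where "a * m + b * n = 1" using assms by (metis bezout_int coprime_imp_gcd_eq_1)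
    then have x: "x = (x * a) * m + (x * b) * n" for x by (metis distrib_left mult.assoc mult.right_neutral)
    have "x \<in> ?I m <+>\<^bsub>\<Z>\<^esub> ?I n" for x
    proof -
      have "x * a * m \<in> ?I m" "x * b * n \<in> ?I n" by (simp_all add: mem)
      then show ?thesis unfolding set_add_def' using x[of x] by auto
    qed
    then show ?thesis by auto
  qed
  ultimately show ?thesis
    using ring.chinese_remainder_simple[OF int.ring_axioms, of "?I m" "?I n"]
    by (simp add: ZFact_def int.genideal_ideal)
qed

lemma divisible_count_mono:
  "list_all2 (dvd) ns ms \<Longrightarrow> divisible_count q ns \<le> divisible_count q ms"
  by (induction rule: list_all2_induct) (auto dest: dvd_trans)

text \<open>This is the one arithmetic reason for the monotonicity: raising the exponent of a prime only enlarges the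
  cyclic factors of the unit group, each to a multiple of its former order.\<close>

lemma unit_factors_dvd:
  assumes "Factorial_Ring.prime p"
  shows "list_all2 (dvd) (unit_factors p a) (unit_factors p (Suc a))"
proof -
  consider "p = 2" "a \<ge> 3" | "p = 2" "a = 2" | "\<not> (p = 2 \<and> Suc a \<ge> 3)" by linarith
  then show ?thesis
  proof cases
    case 1
    then have "(2::nat) ^ (a - 2) dvd 2 ^ (Suc a - 2)" by (intro le_imp_power_dvd) simp
    with 1 show ?thesis by (simp add: unit_factors_def del: power_Suc)
  next
    case 2
    have "totient (2 ^ 2) = 2" by (simp add: totient_prime_power)
    with 2 show ?thesis by (simp add: unit_factors_def)
  next
    case 3
    have "totient (p ^ a) dvd totient (p ^ Suc a)"
      by (intro totient_dvd le_imp_power_dvd) simp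
    moreover have "\<not> (p = 2 \<and> a \<ge> 3)" using 3 by linarith
    ultimately show ?thesis using 3 by (simp only: unit_factors_def if_False list_all2_Cons) simp
  qed
qed

text \<open>The increase of the count at \<open>q\<close> caused by the last step of the prime power \<open>r = p^a\<close>, that is, on passing
  from the units modulo \<open>p^(a-1)\<close> to those modulo \<open>p^a\<close>. By \<open>unit_factors_dvd\<close> the truncated
  subtraction is a true difference.\<close>

definition unit_weight :: "nat \<Rightarrow> nat \<Rightarrow> nat"
  where "unit_weight q r = (let p = aprimedivisor r; a = multiplicity p r in
    divisible_count q (unit_factors p a) - divisible_count q (unit_factors p (a - 1)))"

lemma unit_weight_prime_power:
  assumes "Factorial_Ring.prime p"
  shows "unit_weight q (p ^ Suc a) =
    divisible_count q (unit_factors p (Suc a)) - divisible_count q (unit_factors p a)"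
proof -
  have "aprimedivisor (p ^ Suc a) = p" using assms by (intro aprimedivisor_prime_power) simp_all
  moreover have "multiplicity p (p ^ Suc a) = Suc a"
    using assms by (intro multiplicity_same_power) (auto dest: prime_gt_1_nat)
  ultimately show ?thesis unfolding unit_weight_def Let_def by simp
qed

lemma primepow_factors_prime_power:
  assumes "Factorial_Ring.prime (p::nat)"
  shows "primepow_factors (p ^ a) = (\<lambda>j. p ^ Suc j) ` {..<a}"
proof (intro equalityI subsetI)
  fix r assume "r \<in> primepow_factors (p ^ a)"
  then have r: "primepow r" "r dvd p ^ a" by (auto simp: primepow_factors_def)
  then obtain j where j: "j \<le> a" "r = p ^ j" using divides_primepow_nat[OF assms] by blast
  moreover have "j \<noteq> 0" using j(2) primepow_gt_Suc_0[OF r(1)] by (cases j) simp_all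
  ultimately show "r \<in> (\<lambda>j. p ^ Suc j) ` {..<a}"
    by (intro image_eqI[of _ _ "j - 1"]) (auto simp del: power_Suc)
next
  fix r assume "r \<in> (\<lambda>j. p ^ Suc j) ` {..<a}"
  then obtain j where j: "j < a" "r = p ^ Suc j" by blast
  then have "r dvd p ^ a" by (auto intro: le_imp_power_dvd simp del: power_Suc)
  moreover have "primepow r" unfolding j(2) primepow_def using assms by blast
  ultimately show "r \<in> primepow_factors (p ^ a)" by (simp add: primepow_factors_def)
qed

text \<open>Telescoping over the powers \<open>p, p^2, ..., p^a\<close>. The condition \<open>q > 1\<close> gives the empty start: the units
  modulo 1 have cyclic factors of order 1 only, which \<open>q\<close> does not divide.\<close>

lemma divisible_count_unit_factors:
  assumes p: "Factorial_Ring.prime p" and "q > 1"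
  shows "divisible_count q (unit_factors p a) = (\<Sum>r\<in>primepow_factors (p ^ a). unit_weight q r)"
proof -
  have "inj_on (\<lambda>j. p ^ Suc j) {..<a}"
    using prime_gt_1_nat[OF p] by (auto simp: inj_on_def)
  then have "(\<Sum>r\<in>primepow_factors (p ^ a). unit_weight q r) = (\<Sum>j<a. unit_weight q (p ^ Suc j))"
    unfolding primepow_factors_prime_power[OF p] by (simp add: sum.reindex del: power_Suc)
  also have "\<dots> = divisible_count q (unit_factors p a)"
  proof (induction a)
    case 0
    then show ?case using \<open>q > 1\<close> by (simp add: unit_factors_def)
  next
    case (Suc a)
    have "divisible_count q (unit_factors p a) \<le> divisible_count q (unit_factors p (Suc a))"
      by (rule divisible_count_mono[OF unit_factors_dvd[OF p]])
    with Suc show ?case by (simp add: unit_weight_prime_power[OF p] del: power_Suc)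
  qed
  finally show ?thesis by simp
qed

lemma sum_primepow_factors_mult:
  fixes m n :: nat
  assumes "coprime m n" "m > 0" "n > 0"
  shows "(\<Sum>r\<in>primepow_factors (m * n). f r) = (\<Sum>r\<in>primepow_factors m. f r) + (\<Sum>r\<in>primepow_factors n. f r)"
proof -
  have split: "r dvd m \<or> r dvd n" if "primepow r" "r dvd m * n" for r
  proof -
    obtain p k where p: "Factorial_Ring.prime p" "r = p ^ k" using \<open>primepow r\<close> by (auto simp: primepow_def)
    have "\<not> (p dvd m \<and> p dvd n)" using assms(1) p(1) by (meson coprime_common_divisor not_prime_unit)
    then have "coprime r m \<or> coprime r n"
      unfolding p(2) using prime_imp_coprime[OF p(1)] by (metis coprime_power_left_iff)
    then show ?thesis using that(2) coprime_dvd_mult_left_iff coprime_dvd_mult_right_iff by blast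
  qed
  have "primepow_factors (m * n) = primepow_factors m \<union> primepow_factors n"
    unfolding primepow_factors_def using split by (auto intro: dvd_mult dvd_mult2)
  moreover have "primepow_factors m \<inter> primepow_factors n = {}"
  proof -
    have "\<not> (primepow r \<and> r dvd m \<and> r dvd n)" for r
      using assms(1) primepow_gt_Suc_0[of r] coprime_common_divisor[of m n r] by auto
    then show ?thesis by (auto simp: primepow_factors_def)
  qed
  ultimately show ?thesis
    using assms(2,3) by (simp add: sum.union_disjoint finite_primepow_factors)
qed

text \<open>By the Chinese remainder theorem the prime powers in \<open>n\<close> contribute independently, and
  \<open>sum_primepow_factors_mult\<close> says the same of the sum of weights.\<close>

lemma cyclic_type_units_ZFact_ex:
  assumes "n \<ge> 1"
  shows "\<exists>us. cyclic_type (units_of (ZFact (int n))) us \<and>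
    (\<forall>q>1. divisible_count q us = (\<Sum>r\<in>primepow_factors n. unit_weight q r))"
  using assms
proof (induction n rule: less_induct)
  case (less n)
  show ?case
  proof (cases "n = 1")
    case True
    \<comment> \<open>The modulus 1 is covered as the zeroth power of any prime.\<close>
    then show ?thesis
      using cyclic_type_units_prime_power[OF two_is_prime_nat, of 0]
        divisible_count_unit_factors[OF two_is_prime_nat, of _ 0]
      by (intro exI[of _ "unit_factors 2 0"]) simp
  next
    case False
    then obtain p where p: "Factorial_Ring.prime p" "p dvd n" using prime_factor_nat by blast
    have "n \<noteq> 0" "\<not> is_unit p" using less.prems p(1) by auto
    then obtain m where m: "n = p ^ multiplicity p n * m" "\<not> p dvd m"
      by (rule multiplicity_decompose')
    define a where "a = multiplicity p n"
    have "a > 0" using p \<open>n \<noteq> 0\<close> by (simp add: a_def prime_multiplicity_gt_zero_iff)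
    have n: "n = p ^ a * m" using m(1) unfolding a_def .
    have "m > 0" using n \<open>n \<noteq> 0\<close> by (cases m) auto
    have pa: "p ^ a > 1" using prime_gt_1_nat[OF p(1)] \<open>a > 0\<close> by (rule one_less_power)
    then have "m < n" using \<open>m > 0\<close> by (subst n) simp
    moreover have "m \<ge> 1" using \<open>m > 0\<close> by simp
    ultimately obtain us where us: "cyclic_type (units_of (ZFact (int m))) us"
      "\<forall>q>1. divisible_count q us = (\<Sum>r\<in>primepow_factors m. unit_weight q r)"
      using less.IH[of m] by blast
    have cop: "coprime (p ^ a) m" using prime_imp_coprime[OF p(1) m(2)] by simp
    let ?P = "ZFact (int (p ^ a))" and ?M = "ZFact (int m)"
    have gr: "group (units_of (ZFact k))" for k
      using ring_ZFact[of k] by (intro monoid.units_group ring.is_monoid)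
    have "ZFact (int n) \<simeq> RDirProd ?P ?M"
      using ZFact_mult_coprime[of "int (p ^ a)" "int m"] cop unfolding n by simp
    then have "units_of (ZFact (int n)) \<cong> units_of (RDirProd ?P ?M)"
      by (intro is_ring_iso_units_of RDirProd_ring ring_ZFact)
    also have "\<dots> \<cong> units_of ?P \<times>\<times> units_of ?M" by (rule units_of_RDirProd)
    finally have "units_of ?P \<times>\<times> units_of ?M \<cong> units_of (ZFact (int n))"
      by (rule group.iso_sym[OF gr])
    then have "cyclic_type (units_of (ZFact (int n))) (unit_factors p a @ us)"
      using cyclic_type_DirProd[OF gr gr cyclic_type_units_prime_power[OF p(1)] us(1)] cyclic_type_iso
      by blast
    moreover have "divisible_count q (unit_factors p a @ us) = (\<Sum>r\<in>primepow_factors n. unit_weight q r)"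
      if "q > 1" for q
    proof -
      have "p ^ a > 0" using pa by linarith
      then have "(\<Sum>r\<in>primepow_factors n. unit_weight q r) =
          (\<Sum>r\<in>primepow_factors (p ^ a). unit_weight q r) + (\<Sum>r\<in>primepow_factors m. unit_weight q r)"
        unfolding n using \<open>m > 0\<close> by (rule sum_primepow_factors_mult[OF cop])
      then show ?thesis
        using us(2) that by (simp only: divisible_count_simps divisible_count_unit_factors[OF p(1) that])
    qed
    ultimately show ?thesis by blast
  qed
qed

lemma cyclic_type_units_cyclic_sum:
  assumes "\<forall>n\<in>set ns. n \<ge> 1"
  shows "\<exists>us. cyclic_type (units_of (cyclic_sum ns)) us \<and>
    (\<forall>q>1. divisible_count q us = (\<Sum>n\<leftarrow>ns. \<Sum>r\<in>primepow_factors n. unit_weight q r))"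
  using assms
proof (induction ns)
  case Nil
  have "Units (nil_ring :: int set list ring) = {[]}" by (auto simp: Units_def monoid.defs)
  then have "(\<lambda>x. x) \<in> iso (add_monoid (cyclic_sum [])) (units_of (cyclic_sum []))"
    by (simp add: iso_iff hom_def units_of_def monoid.defs)
  then have "cyclic_type (units_of (cyclic_sum [])) []"
    unfolding cyclic_type_def using is_isoI by fastforce
  then show ?case by (intro exI[of _ "[]"]) simp
next
  case (Cons n ns)
  then obtain us where us: "cyclic_type (units_of (cyclic_sum ns)) us"
    "\<forall>q>1. divisible_count q us = (\<Sum>n\<leftarrow>ns. \<Sum>r\<in>primepow_factors n. unit_weight q r)" by auto
  obtain vs where vs: "cyclic_type (units_of (ZFact (int n))) vs"
    "\<forall>q>1. divisible_count q vs = (\<Sum>r\<in>primepow_factors n. unit_weight q r)"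
    using cyclic_type_units_ZFact_ex[of n] Cons.prems by auto
  have "cyclic_type (units_of (ZFact (int n)) \<times>\<times> units_of (cyclic_sum ns)) (vs @ us)"
    by (rule cyclic_type_DirProd[OF _ _ vs(1) us(1)])
      (rule monoid.units_group ring.is_monoid ring_ZFact ring_cyclic_sum)+
  moreover have "units_of (ZFact (int n)) \<times>\<times> units_of (cyclic_sum ns)
      \<cong> units_of (RDirProd (ZFact (int n)) (cyclic_sum ns))"
    by (rule group.iso_sym[OF _ units_of_RDirProd])
      (rule monoid.units_group ring.is_monoid RDirProd_ring ring_ZFact ring_cyclic_sum)+
  moreover have "units_of (RDirProd (ZFact (int n)) (cyclic_sum ns)) \<cong> units_of (cyclic_sum (n # ns))"
    by (rule is_ring_iso_units_of[OF RDirProd_ring[OF ring_ZFact ring_cyclic_sum] ring_cyclic_sum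
          cyclic_sum_Cons])
  ultimately have "cyclic_type (units_of (cyclic_sum (n # ns))) (vs @ us)"
    by (rule cyclic_type_iso[OF cyclic_type_iso])
  then show ?case using us(2) vs(2) by (intro exI[of _ "vs @ us"]) simp
qed

text \<open>The rings for which a further group of units can be formed: those isomorphic to a direct sum of
  rings \<open>\<int>\<^sub>n\<close>. The orders are part of the predicate because the argument follows them.\<close>

definition cyclic_ring :: "'a ring \<Rightarrow> nat list \<Rightarrow> bool"
  where "cyclic_ring R ns \<longleftrightarrow> ring R \<and> (\<forall>n\<in>set ns. n \<ge> 1) \<and> cyclic_sum ns \<simeq> R"

text \<open>The decomposition that defines \<open>units_ring R\<close> is unknown, but the explicit one has the same
  counts, since both present the same group.\<close>

lemma cyclic_ring_units_ring:
  assumes "cyclic_ring R ns"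
  shows "\<exists>us. cyclic_ring (units_ring R) us \<and>
    (\<forall>q. primepow q \<longrightarrow> divisible_count q us = (\<Sum>n\<leftarrow>ns. \<Sum>r\<in>primepow_factors n. unit_weight q r))"
proof -
  have R: "ring R" and ns: "\<forall>n\<in>set ns. n \<ge> 1" and iso: "cyclic_sum ns \<simeq> R"
    using assms by (auto simp: cyclic_ring_def)
  obtain us where us: "cyclic_type (units_of (cyclic_sum ns)) us"
    "\<forall>q>1. divisible_count q us = (\<Sum>n\<leftarrow>ns. \<Sum>r\<in>primepow_factors n. unit_weight q r)"
    using cyclic_type_units_cyclic_sum[OF ns] by blast
  have us_R: "cyclic_type (units_of R) us"
    by (rule cyclic_type_iso[OF us(1) is_ring_iso_units_of[OF ring_cyclic_sum R iso]])
  then obtain \<phi> where "units_decomposition R us \<phi>"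
    unfolding cyclic_type_def units_decomposition_def is_iso_def by blast
  note U = units_ring_structure[OF R this]
  obtain vs where vs: "\<forall>n\<in>set vs. n \<ge> 1" "cyclic_sum vs \<simeq> units_ring R" using U(5) by blast
  \<comment> \<open>Addition in \<open>units_ring R\<close> is multiplication in \<open>R\<close>, and both sides have the carrier \<open>Units R\<close>.\<close>
  have "(\<lambda>x. x) \<in> iso (units_of R) (add_monoid (units_ring R))"
    using U(4) ring.ring_simprules(1)[OF U(1)] unfolding iso_iff hom_def units_of_def
    by (auto simp: U(2))
  then have "units_of R \<cong> add_monoid (units_ring R)" by (rule is_isoI)
  also have "\<dots> \<cong> add_monoid (cyclic_sum vs)"
    by (rule group.iso_sym[OF group_cyclic_sum is_ring_iso_add_monoid[OF vs(2)]])
  finally have "add_monoid (cyclic_sum us) \<cong> add_monoid (cyclic_sum vs)"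
    using us_R iso_trans unfolding cyclic_type_def by blast
  moreover have "\<forall>n\<in>set us. n \<ge> 1" using us_R by (simp add: cyclic_type_def)
  ultimately have "divisible_count q us = divisible_count q vs" if "primepow q" for q
    using divisible_count_unique vs(1) that by blast
  moreover have "q > 1" if "primepow q" for q :: nat using primepow_gt_Suc_0[OF that] by simp
  ultimately show ?thesis using us(2) vs U(1) unfolding cyclic_ring_def by metis
qed

section \<open>Monotonicity of the iterated groups of units\<close>

text \<open>Interchanging the two sums turns the count of the units into a linear form in the counts of
  the ring itself.\<close>

lemma sum_list_primepow_factors:
  fixes w :: "nat \<Rightarrow> nat"
  assumes "finite P" "\<And>n. n \<in> set ns \<Longrightarrow> primepow_factors n \<subseteq> P" "\<And>r. r \<in> P \<Longrightarrow> primepow r"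
  shows "(\<Sum>n\<leftarrow>ns. \<Sum>r\<in>primepow_factors n. w r) = (\<Sum>r\<in>P. w r * divisible_count r ns)"
  using assms(2)
proof (induction ns)
  case (Cons n ns)
  have "(\<Sum>r\<in>primepow_factors n. w r) = (\<Sum>r\<in>P. if r dvd n then w r else 0)"
    using assms(1,3) Cons.prems[of n]
    by (intro sum.mono_neutral_cong_left) (auto simp: primepow_factors_def)
  moreover have "(\<Sum>n\<leftarrow>ns. \<Sum>r\<in>primepow_factors n. w r) = (\<Sum>r\<in>P. w r * divisible_count r ns)"
    using Cons by simp
  ultimately show ?case
    by (auto simp: sum.distrib[symmetric] intro!: sum.cong)
qed simp

text \<open>The linear form has nonnegative coefficients, so it is monotone.\<close>

lemma units_ring_dominance:
  assumes "cyclic_ring R ns" "cyclic_ring S ms"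
    and dom: "\<And>q. primepow q \<Longrightarrow> divisible_count q ns \<le> divisible_count q ms"
  shows "\<exists>us vs. cyclic_ring (units_ring R) us \<and> cyclic_ring (units_ring S) vs \<and>
    (\<forall>q. primepow q \<longrightarrow> divisible_count q us \<le> divisible_count q vs)"
proof -
  define P where "P = (\<Union>n\<in>set ns \<union> set ms. primepow_factors n)"
  have pos: "n > 0" if "n \<in> set ns \<union> set ms" for n
    using assms(1,2) that by (auto simp: cyclic_ring_def Suc_le_eq)
  have "finite P" unfolding P_def using pos by (auto intro!: finite_primepow_factors)
  have P: "primepow r" if "r \<in> P" for r using that by (auto simp: P_def primepow_factors_def)
  have "(\<Sum>n\<leftarrow>ns. \<Sum>r\<in>primepow_factors n. unit_weight q r) \<le> (\<Sum>n\<leftarrow>ms. \<Sum>r\<in>primepow_factors n. unit_weight q r)" for q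
  proof -
    have "(\<Sum>n\<leftarrow>xs. \<Sum>r\<in>primepow_factors n. unit_weight q r) = (\<Sum>r\<in>P. unit_weight q r * divisible_count r xs)"
      if "set xs \<subseteq> set ns \<union> set ms" for xs
      using that by (intro sum_list_primepow_factors \<open>finite P\<close> P) (auto simp: P_def)
    then show ?thesis using dom P by (auto intro!: sum_mono mult_left_mono)
  qed
  then show ?thesis
    using cyclic_ring_units_ring[OF assms(1)] cyclic_ring_units_ring[OF assms(2)] by (metis (full_types))
qed

lemma iterated_units_dominance:
  assumes "cyclic_ring R ns" "cyclic_ring S ms"
    and "\<And>q. primepow q \<Longrightarrow> divisible_count q ns \<le> divisible_count q ms"
  shows "\<exists>us vs. cyclic_ring (iterated_units k R) us \<and> cyclic_ring (iterated_units k S) vs \<and>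
    (\<forall>q. primepow q \<longrightarrow> divisible_count q us \<le> divisible_count q vs)"
proof (induction k)
  case 0
  then show ?case using assms by (auto simp: iterated_units_def)
next
  case (Suc k)
  then show ?case
    unfolding iterated_units_def funpow.simps comp_apply using units_ring_dominance by blast
qed

lemma card_cyclic_ring:
  assumes "cyclic_ring R ns"
  shows "card (carrier R) = prod_list ns"
proof -
  have "card (carrier R) = card (carrier (cyclic_sum ns))"
    using assms ring_iso_same_card unfolding cyclic_ring_def by metis
  \<comment> \<open>Every element is killed by 0, and \<open>gcd 0 n = n\<close>.\<close>
  also have "\<dots> = torsion_count (add_monoid (cyclic_sum ns)) 0"
    by (simp add: torsion_count_def)
  also have "\<dots> = prod_list ns"
    using assms torsion_count_cyclic_sum[of ns 0] by (simp add: cyclic_ring_def)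
  finally show ?thesis .
qed

lemma iso_zero_ring_iff:
  assumes "ring R"
  shows "R \<simeq> zero_ring \<longleftrightarrow> card (carrier R) = 1"
proof
  assume "R \<simeq> zero_ring"
  then show "card (carrier R) = 1" using ring_iso_same_card[of R zero_ring] by (simp add: zero_ring_def)
next
  assume "card (carrier R) = 1"
  then obtain x where "carrier R = {x}" by (rule card_1_singletonE)
  then have "(\<lambda>x. 0) \<in> ring_iso R zero_ring"
    by (auto simp: ring_iso_def ring_hom_def zero_ring_def bij_betw_def)
  then show "R \<simeq> zero_ring" by (auto simp: is_ring_iso_def)
qed

text \<open>A nontrivial order is divisible by a prime, so the counts detect it.\<close>

lemma cyclic_ring_trivial_iff:
  assumes "cyclic_ring R ns"
  shows "R \<simeq> zero_ring \<longleftrightarrow> (\<forall>q. primepow q \<longrightarrow> divisible_count q ns = 0)"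
proof -
  have "R \<simeq> zero_ring \<longleftrightarrow> prod_list ns = 1"
    using assms iso_zero_ring_iff card_cyclic_ring by (metis cyclic_ring_def)
  also have "\<dots> \<longleftrightarrow> (\<forall>n\<in>set ns. n = 1)"
    by (induction ns) auto
  also have "\<dots> \<longleftrightarrow> (\<forall>q. primepow q \<longrightarrow> divisible_count q ns = 0)"
  proof
    assume "\<forall>n\<in>set ns. n = 1"
    then show "\<forall>q. primepow q \<longrightarrow> divisible_count q ns = 0"
      using primepow_gt_Suc_0 by (fastforce simp: divisible_count_def filter_empty_conv)
  next
    assume *: "\<forall>q. primepow q \<longrightarrow> divisible_count q ns = 0"
    show "\<forall>n\<in>set ns. n = 1"
    proof (rule ballI, rule ccontr)
      fix n assume n: "n \<in> set ns" "n \<noteq> 1"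
      then obtain p where "Factorial_Ring.prime p" "p dvd n" using prime_factor_nat by blast
      then show False using * n(1) primepow_prime[of p] by (auto simp: divisible_count_def filter_empty_conv)
    qed
  qed
  finally show ?thesis .
qed

lemma cyclic_ring_ZFact:
  assumes "n \<ge> 1"
  shows "cyclic_ring (ZFact (int n)) [n]"
  using assms ring_ZFact cyclic_sum_singleton by (simp add: cyclic_ring_def)

theorem theorem12:
  fixes k n :: nat
  assumes "k \<ge> 1" and "n \<ge> 1"
    and "iterated_units k (ZFact (int n)) \<simeq> zero_ring"
  shows "\<forall>m::nat. m \<ge> 1 \<and> m dvd n \<longrightarrow> iterated_units k (ZFact (int m)) \<simeq> zero_ring"
proof (intro allI impI)
  fix m :: nat assume m: "m \<ge> 1 \<and> m dvd n"
  have "divisible_count q [m] \<le> divisible_count q [n]" for q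
    using m by (auto dest: dvd_trans)
  then obtain us vs where
    us: "cyclic_ring (iterated_units k (ZFact (int m))) us" and
    vs: "cyclic_ring (iterated_units k (ZFact (int n))) vs" and
    le: "\<And>q. primepow q \<Longrightarrow> divisible_count q us \<le> divisible_count q vs"
    using iterated_units_dominance[OF cyclic_ring_ZFact cyclic_ring_ZFact, of m n] m assms(2) by blast
  show "iterated_units k (ZFact (int m)) \<simeq> zero_ring"
    using le assms(3) unfolding cyclic_ring_trivial_iff[OF us] cyclic_ring_trivial_iff[OF vs] by fastforce
qed

end
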